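(* Let $n\ge 2$ and let $\mathcal C\subset\mathbb R^n$ be a convex polytope with nonempty interior and without parallel facets. Then there exists a bounded set $U\subset\mathbb R^n$ such that if $O\notin U$ (and $O\notin\mathcal C$), the function $G$ corresponding to $\mathcal C$ and $O$ does not have local minimizers intersecting the interior of $\mathcal C$. In particular, every local minimizer of $G$ is contained in the boundary of $\mathcal C$ when $O$ is at a large distance from $\mathcal C$.
   Context: A convex polytope is the convex hull of finitely many points. A facet of $\mathcal C$ is a set $\mathcal C\cap\Pi$, where $\Pi$ is a supporting hyperplane of $\mathcal C$, which has nonempty interior relative to $\Pi$; "without parallel facets" means that no two different facets lie in parallel hyperplanes. $\partial\mathcal C$ is the boundary of $\mathcal C$; $|AB|$ is the Euclidean length of $[AB]$. For a point $O\notin\mathcal C$, consider all segments $[AB]$ with end-points $A,B\in\partial\mathcal C$ such that the line $AB$ passes through $O$ and $B\in[OA]$; put $G([AB])=|AB|$ for such segments. Such a segment $[A^*B^*]$ is a local minimizer for $G$ if there are open sets $U'\ni A^*$ and $V'\ni B^*$ such that $|AB|\ge|A^*B^*|$ for every such segment $[AB]$ with $A\in\partial\mathcal C\cap U'$ and $B\in\partial\mathcal C\cap V'$. *)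

theory Defs
  imports "HOL-Analysis.Analysis"
begin

text \<open>
  For a polytope with nonempty interior, the library's facets are exactly the sets
  \<open>C \<inter> H\<close> with \<open>H\<close> a supporting hyperplane in which \<open>C \<inter> H\<close> has nonempty relative interior.
\<close>

lemma facet_of_iff_supporting_hyperplane:
  fixes C :: "'a::euclidean_space set"
  assumes "polytope C" and "interior C \<noteq> {}"
  shows "F facet_of C \<longleftrightarrow>
    (\<exists>a b. a \<noteq> 0 \<and> C \<subseteq> {x. a \<bullet> x \<le> b} \<and> F = C \<inter> {x. a \<bullet> x = b} \<and>
           top_of_set {x. a \<bullet> x = b} interior_of F \<noteq> {})"
    (is "?L \<longleftrightarrow> ?R")
proof
  have dimC: "aff_dim C = DIM('a)"
    using assms(2) by (simp add: aff_dim_nonempty_interior)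
  {
    assume ?L
    then have F: "F face_of C" "F \<noteq> {}" "aff_dim F = DIM('a) - 1"
      using dimC by (auto simp: facet_of_def)
    have "F exposed_face_of C"
      using F(1) assms(1) exposed_face_of_polyhedron polytope_imp_polyhedron by blast
    then obtain a b where ab: "C \<subseteq> {x. a \<bullet> x \<le> b}" "F = C \<inter> {x. a \<bullet> x = b}"
      by (auto simp: exposed_face_of_def)
    have "F \<noteq> C"
      using F(3) dimC by auto
    then have a: "a \<noteq> 0"
      using ab F(2) by (auto split: if_splits)
    let ?H = "{x. a \<bullet> x = b}"
    have "affine hull F = affine hull ?H"
      by (subst aff_dim_eq_full_gen[symmetric]) (use ab a F in auto)
    then have hull: "affine hull F = ?H"
      by (simp add: affine_hyperplane hull_same)
    have "convex F"
      using F(1) face_of_imp_convex by blast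
    then have "rel_interior F \<noteq> {}"
      using F(2) rel_interior_eq_empty by blast
    moreover have "rel_interior F \<subseteq> top_of_set ?H interior_of F"
      by (metis hull interior_of_maximal openin_rel_interior rel_interior_subset)
    ultimately show ?R
      using a ab by blast
  }
  {
    assume ?R
    then obtain a b where ab: "a \<noteq> 0" "C \<subseteq> {x. a \<bullet> x \<le> b}" "F = C \<inter> {x. a \<bullet> x = b}"
      and ne: "top_of_set {x. a \<bullet> x = b} interior_of F \<noteq> {}"
      by blast
    let ?H = "{x. a \<bullet> x = b}"
    let ?T = "top_of_set ?H interior_of F"
    have sub: "?T \<subseteq> F"
      by (rule interior_of_subset)
    have "aff_dim ?T = aff_dim ?H"
      by (rule aff_dim_openin[OF _ affine_hyperplane ne]) auto
    then have "aff_dim ?H \<le> aff_dim F"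
      using aff_dim_subset[OF sub] by simp
    moreover have "aff_dim F \<le> aff_dim ?H"
      using ab(3) by (intro aff_dim_subset) auto
    ultimately have "aff_dim F = aff_dim C - 1"
      using ab(1) dimC by simp
    moreover have "F face_of C"
      unfolding ab(3) using ab(2) assms(1)
      by (intro face_of_Int_supporting_hyperplane_le polytope_imp_convex) auto
    moreover have "F \<noteq> {}"
      using sub ne by auto
    ultimately show ?L
      by (simp add: facet_of_def)
  }
qed

definition parallel_hyperplanes :: "'a::euclidean_space set \<Rightarrow> 'a set \<Rightarrow> bool"
  where "parallel_hyperplanes H K \<longleftrightarrow>
    (\<exists>a b c. a \<noteq> 0 \<and> H = {x. a \<bullet> x = b} \<and> K = {x. a \<bullet> x = c})"

definition without_parallel_facets :: "'a::euclidean_space set \<Rightarrow> bool"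
  where "without_parallel_facets C \<longleftrightarrow>
    \<not> (\<exists>F F' H H'. F facet_of C \<and> F' facet_of C \<and> F \<noteq> F' \<and>
         parallel_hyperplanes H H' \<and> F \<subseteq> H \<and> F' \<subseteq> H')"

text \<open>
  A segment \<open>[AB]\<close> is represented by its ordered pair of end-points; the condition
  \<open>B \<in> [OA]\<close> determines the order. \<open>A \<noteq> B\<close> is needed for the line \<open>AB\<close> to make sense.
  The value \<open>G([AB])\<close> is \<open>dist A B\<close>. The point \<open>O\<close> is written \<open>p\<close>, since \<open>O\<close> is an infix symbol.
\<close>

definition segment_through ::
    "'a::euclidean_space set \<Rightarrow> 'a \<Rightarrow> 'a \<Rightarrow> 'a \<Rightarrow> bool"
  where "segment_through C p A B \<longleftrightarrow>
    A \<in> frontier C \<and> B \<in> frontier C \<and> A \<noteq> B \<and>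
    p \<in> affine hull {A, B} \<and> B \<in> closed_segment p A"

definition local_minimizer ::
    "'a::euclidean_space set \<Rightarrow> 'a \<Rightarrow> 'a \<Rightarrow> 'a \<Rightarrow> bool"
  where "local_minimizer C p A B \<longleftrightarrow>
    segment_through C p A B \<and>
    (\<exists>U V. open U \<and> open V \<and> A \<in> U \<and> B \<in> V \<and>
       (\<forall>A' B'. segment_through C p A' B' \<and> A' \<in> frontier C \<inter> U \<and> B' \<in> frontier C \<inter> V
          \<longrightarrow> dist A' B' \<ge> dist A B))"

end

theory Submission
  imports Defs
begin

text \<open>
  Let \<open>[AB]\<close> be a local minimizer meeting the interior, let \<open>D = A - p\<close> and \<open>B = p + r D\<close>, and
  let \<open>a\<close>, \<open>b\<close> be outer normals of facets through \<open>A\<close> and \<open>B\<close>. Rotating the line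
  to the direction \<open>D + e w\<close> with \<open>w\<close> orthogonal to \<open>D\<close>, the new chord is at most as long as the
  segment that the two facet hyperplanes cut out, with equality for \<open>e = 0\<close>. Hence this smooth
  upper bound has a local minimum at \<open>e = 0\<close> too, and its derivative vanishes. Spelled out for all \<open>w\<close>,
  this says that some combination \<open>x a + b\<close> equals \<open>1 - r\<close> times the component of \<open>b\<close> orthogonal
  to \<open>D\<close>, where \<open>1 - r = |AB| / |pA|\<close>. As \<open>a\<close> and \<open>b\<close> are linearly independent and there are
  finitely many facets, \<open>|x a + b|\<close> is bounded below by a constant multiple of \<open>|b|\<close>, so \<open>|pA|\<close> is
  bounded.
\<close>

section \<open>Chords on rotated lines\<close>

text \<open>Being in the interior of \<open>C\<close> and being outside the closed set
  \<open>C\<close> are open conditions, so the two points given by \<open>near\<close> keep them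
  under a small rotation. The segment joining the rotated points is connected and therefore crosses
  the frontier.\<close>

lemma eventually_frontier_point_on_rotated_line:
  fixes C :: "'a::real_normed_vector set"
  assumes "closed C" "open U" "p + t0 *\<^sub>R d \<in> U" "\<eta> > 0"
    and near: "\<And>\<delta>. \<delta> > 0 \<Longrightarrow> \<exists>t1 t2. \<bar>t1 - t0\<bar> < \<delta> \<and> \<bar>t2 - t0\<bar> < \<delta> \<and>
      p + t1 *\<^sub>R d \<in> interior C \<and> p + t2 *\<^sub>R d \<notin> C"
  shows "\<forall>\<^sub>F e in nhds (0::real).
    \<exists>t. \<bar>t - t0\<bar> < \<eta> \<and> p + t *\<^sub>R (d + e *\<^sub>R w) \<in> frontier C \<inter> U"
proof -
  have "((\<lambda>x. p + fst x *\<^sub>R (d + snd x *\<^sub>R w)) \<longlongrightarrow> p + t0 *\<^sub>R (d + 0 *\<^sub>R w))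
      (nhds t0 \<times>\<^sub>F nhds (0::real))"
    by (intro tendsto_intros filterlim_fst filterlim_snd)
  then have "\<forall>\<^sub>F x in nhds t0 \<times>\<^sub>F nhds (0::real). p + fst x *\<^sub>R (d + snd x *\<^sub>R w) \<in> U"
    using assms(2,3) by (auto dest: topological_tendstoD)
  then obtain P Q where PQ: "eventually P (nhds t0)" "eventually Q (nhds (0::real))"
    "\<And>t e. P t \<Longrightarrow> Q e \<Longrightarrow> p + t *\<^sub>R (d + e *\<^sub>R w) \<in> U"
    unfolding eventually_prod_filter by auto
  obtain \<delta> where \<delta>: "\<delta> > 0" "\<And>t. \<bar>t - t0\<bar> < \<delta> \<Longrightarrow> P t"
    using PQ(1) unfolding eventually_nhds_metric dist_real_def by auto
  obtain t1 t2 where t: "\<bar>t1 - t0\<bar> < min \<delta> \<eta>" "\<bar>t2 - t0\<bar> < min \<delta> \<eta>"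
    "p + t1 *\<^sub>R d \<in> interior C" "p + t2 *\<^sub>R d \<notin> C"
    using near[of "min \<delta> \<eta>"] \<delta>(1) assms(4) by auto
  have lim: "((\<lambda>e. p + t *\<^sub>R (d + e *\<^sub>R w)) \<longlongrightarrow> p + t *\<^sub>R (d + 0 *\<^sub>R w)) (nhds (0::real))" for t
    by (intro tendsto_intros filterlim_ident)
  have e1: "\<forall>\<^sub>F e in nhds (0::real). p + t1 *\<^sub>R (d + e *\<^sub>R w) \<in> interior C"
    using topological_tendstoD[OF lim[of t1], of "interior C"] t(3) by auto
  have e2: "\<forall>\<^sub>F e in nhds (0::real). p + t2 *\<^sub>R (d + e *\<^sub>R w) \<in> - C"
    using topological_tendstoD[OF lim[of t2], of "- C"] t(4) assms(1) by (auto simp: open_Compl)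
  show ?thesis
    using PQ(2) e1 e2
  proof eventually_elim
    case (elim e)
    let ?f = "\<lambda>t. p + t *\<^sub>R (d + e *\<^sub>R w)"
    let ?S = "?f ` closed_segment t1 t2"
    have "connected ?S"
      by (intro connected_continuous_image continuous_intros) auto
    moreover have "?f t1 \<in> ?S \<inter> C"
      using elim(2) interior_subset by auto
    moreover have "?f t2 \<in> ?S - C"
      using elim(3) by auto
    ultimately have "?S \<inter> frontier C \<noteq> {}"
      by (intro connected_Int_frontier) blast+
    then obtain s where s: "s \<in> closed_segment t1 t2" "?f s \<in> frontier C"
      by auto
    have "closed_segment t1 t2 \<subseteq> ball t0 (min \<delta> \<eta>)"
      using t by (intro closed_segment_subset) (auto simp: dist_real_def abs_minus_commute)
    then have "\<bar>s - t0\<bar> < min \<delta> \<eta>"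
      using s(1) by (auto simp: dist_real_def abs_minus_commute)
    then show ?case
      using PQ(3)[OF \<delta>(2) elim(1), of s] s(2) by auto
  qed
qed

lemma segment_throughI:
  assumes "p + t *\<^sub>R d \<in> frontier C" "p + t' *\<^sub>R d \<in> frontier C" "0 < t'" "t' < t" "d \<noteq> 0"
  shows "segment_through C p (p + t *\<^sub>R d) (p + t' *\<^sub>R d)"
proof -
  let ?A = "p + t *\<^sub>R d" and ?B = "p + t' *\<^sub>R d"
  \<comment> \<open>The weights x, y of the two end-points solve x + y = 1 and x t + y t' = 0, which
    is parameter 0, the point \<open>p\<close>.\<close>
  have one: "- t' / (t - t') + t / (t - t') = 1"
    using assms diff_divide_distrib[of t t' "t - t'"] by simp
  have "p = (- t' / (t - t')) *\<^sub>R ?A + (t / (t - t')) *\<^sub>R ?B"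
  proof -
    have "(- t' / (t - t')) *\<^sub>R ?A + (t / (t - t')) *\<^sub>R ?B =
        (- t' / (t - t') + t / (t - t')) *\<^sub>R p + (- t' / (t - t') * t + t / (t - t') * t') *\<^sub>R d"
      by (simp add: algebra_simps)
    also have "- t' / (t - t') + t / (t - t') = 1"
      by (rule one)
    also have "- t' / (t - t') * t + t / (t - t') * t' = 0"
      by simp
    finally show ?thesis by simp
  qed
  then have "p \<in> affine hull {?A, ?B}"
    using one unfolding affine_hull_2 by blast
  moreover have "?B \<in> closed_segment p ?A"
    unfolding in_segment using assms
    by (intro exI[of _ "t' / t"]) (auto simp: algebra_simps)
  ultimately show ?thesis
    using assms by (auto simp: segment_through_def)
qed

section \<open>First-order condition at a local minimizer\<close>

text \<open>Here \<open>a\<close> and \<open>b\<close> may be the outer normals of any supporting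
  hyperplanes at \<open>A\<close> and \<open>B\<close>. As \<open>dist A B\<close> is at most the
  diameter of a bounded \<open>C\<close>, a far away \<open>p\<close> forces some
  \<open>x *\<^sub>R a + b\<close> to be small relative to \<open>b\<close>. The witness is
  \<open>x = \<beta> / \<alpha>\<close>.\<close>

lemma local_minimizer_normals_nearly_parallel:
  fixes C :: "'a::euclidean_space set"
  assumes "closed C" "convex C" "p \<notin> C"
    and lm: "local_minimizer C p A B"
    and meets: "closed_segment A B \<inter> interior C \<noteq> {}"
    and a: "a \<noteq> 0" "C \<subseteq> {x. a \<bullet> x \<le> a \<bullet> A}"
    and b: "b \<noteq> 0" "C \<subseteq> {x. b \<bullet> x \<le> b \<bullet> B}"
  shows "\<exists>x. dist p A * norm (x *\<^sub>R a + b) \<le> dist A B * norm b"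
proof -
  have st: "segment_through C p A B"
    using lm by (simp add: local_minimizer_def)
  obtain U V where UV: "open U" "open V" "A \<in> U" "B \<in> V"
    and min: "\<And>A' B'. segment_through C p A' B' \<Longrightarrow> A' \<in> U \<Longrightarrow> B' \<in> V \<Longrightarrow> dist A B \<le> dist A' B'"
    using lm unfolding local_minimizer_def segment_through_def by blast
  have AB: "A \<in> frontier C" "B \<in> frontier C" "A \<noteq> B" "B \<in> closed_segment p A"
    using st by (auto simp: segment_through_def)
  have ABC: "A \<in> C" "B \<in> C"
    using AB assms(1) frontier_subset_closed by blast+
  define D where "D = A - p"
  obtain r where r: "B = (1 - r) *\<^sub>R p + r *\<^sub>R A" "0 \<le> r" "r \<le> 1"
    using AB(4) by (auto simp: in_segment)
  have A_eq: "A = p + 1 *\<^sub>R D" and B_eq: "B = p + r *\<^sub>R D"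
    by (simp_all add: D_def r(1) algebra_simps)
  have "r \<noteq> 0" "r \<noteq> 1"
    using AB(3) ABC assms(3) r(1) by auto
  then have r01: "0 < r" "r < 1"
    using r by auto
  have D0: "D \<noteq> 0"
    using AB(3) A_eq B_eq by auto

  obtain z where z: "z \<in> closed_segment A B" "z \<in> interior C"
    using meets by blast
  obtain v where v: "z = (1 - v) *\<^sub>R A + v *\<^sub>R B" "0 \<le> v" "v \<le> 1"
    using z(1) by (auto simp: in_segment)
  have "z \<noteq> A" "z \<noteq> B"
    using z(2) AB by (auto simp: frontier_def)
  then have v01: "0 < v" "v < 1"
    using v by (auto simp: less_le)
  have int_lt: "c \<bullet> z < k" if "c \<noteq> 0" "C \<subseteq> {x. c \<bullet> x \<le> k}" for c k
    using interior_mono[OF that(2)] z(2) that(1) by auto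
  have seg: "open_segment z A \<subseteq> interior C" "open_segment z B \<subseteq> interior C"
    using in_interior_closure_convex_segment[OF assms(2) z(2)] ABC closure_subset by blast+
  define \<tau> where "\<tau> = 1 - v + v * r"
  have z_eq: "z = p + \<tau> *\<^sub>R D"
    unfolding v(1) A_eq B_eq \<tau>_def by (simp add: algebra_simps)
  have "\<tau> = 1 - v * (1 - r)" "\<tau> = r + (1 - v) * (1 - r)"
    by (simp_all add: \<tau>_def algebra_simps)
  moreover have "v * (1 - r) > 0" "(1 - v) * (1 - r) > 0"
    using v01 r01 by simp_all
  ultimately have \<tau>: "r < \<tau>" "\<tau> < 1"
    by linarith+
  have inner: "p + t *\<^sub>R D \<in> interior C" if "r < t" "t < 1" for t
  proof -
    have osr: "p + t *\<^sub>R D \<in> open_segment (p + x *\<^sub>R D) (p + y *\<^sub>R D)"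
      if "x < t \<and> t < y \<or> y < t \<and> t < x" for x y
    proof -
      have "t \<in> open_segment x y"
        using that by (auto simp: open_segment_eq_real_ivl)
      then obtain q where q: "0 < q" "q < 1" "t = (1 - q) * x + q * y" "x \<noteq> y"
        by (auto simp: in_segment)
      have "p + t *\<^sub>R D = (1 - q) *\<^sub>R (p + x *\<^sub>R D) + q *\<^sub>R (p + y *\<^sub>R D)"
        unfolding q(3) by (simp add: algebra_simps)
      moreover have "p + x *\<^sub>R D \<noteq> p + y *\<^sub>R D"
        using q(4) D0 by simp
      ultimately show ?thesis
        unfolding in_segment using q(1,2) by blast
    qed
    show ?thesis
    proof (cases t \<tau> rule: linorder_cases)
      case less
      then show ?thesis using osr[of r \<tau>] osr[of \<tau> r] that seg(2) unfolding z_eq B_eq by auto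
    next
      case equal
      then show ?thesis using z z_eq by simp
    next
      case greater
      then show ?thesis using osr[of \<tau> 1] that seg(1) unfolding z_eq A_eq by auto
    qed
  qed

  \<comment> \<open>The signs are chosen so that both numbers are positive: \<open>z\<close> lies
    strictly inside both half-spaces, so the ray enters \<open>C\<close> at \<open>B\<close> and
    leaves it at \<open>A\<close>.\<close>
  define \<alpha> \<beta> where "\<alpha> = a \<bullet> D" and "\<beta> = - (b \<bullet> D)"
  have "(\<tau> - 1) * \<alpha> < 0"
    using int_lt[OF a] unfolding z_eq A_eq by (simp add: \<alpha>_def algebra_simps)
  then have \<alpha>: "\<alpha> > 0"
    using \<tau> by (simp add: mult_less_0_iff)
  have "0 < (\<tau> - r) * \<beta>"
    using int_lt[OF b] unfolding z_eq B_eq by (simp add: \<beta>_def algebra_simps)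
  then have \<beta>: "\<beta> > 0"
    using \<tau> by (simp add: zero_less_mult_iff)
  have outA: "p + t *\<^sub>R D \<notin> C" if "t > 1" for t
  proof
    assume "p + t *\<^sub>R D \<in> C"
    then have "(t - 1) * \<alpha> \<le> 0"
      using a(2) unfolding A_eq by (auto simp: \<alpha>_def algebra_simps)
    then show False
      using that \<alpha> by (simp add: mult_le_0_iff)
  qed
  have outB: "p + t *\<^sub>R D \<notin> C" if "t < r" for t
  proof
    assume "p + t *\<^sub>R D \<in> C"
    then have "(r - t) * \<beta> \<le> 0"
      using b(2) unfolding B_eq by (auto simp: \<beta>_def algebra_simps)
    then show False
      using that \<beta> by (simp add: mult_le_0_iff)
  qed

  have crit: "(a \<bullet> w) / \<alpha> + r * (b \<bullet> w) / \<beta> = 0" if w: "w \<bullet> D = 0" for w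
  proof -
    \<comment> \<open>The line in direction \<open>D + e *\<^sub>R w\<close> meets the hyperplanes
      with normals \<open>a\<close> and \<open>b\<close> at the two parameters in the bracket. The
      square root is the norm of the direction, because \<open>w\<close> is orthogonal to
      \<open>D\<close>.\<close>
    define g where "g = (\<lambda>e. sqrt (D \<bullet> D + e\<^sup>2 * (w \<bullet> w)) *
      (\<alpha> / (\<alpha> + e * (a \<bullet> w)) - r * \<beta> / (\<beta> - e * (b \<bullet> w))))"
    \<comment> \<open>\<open>\<eta> \<le> r\<close> keeps the rotated copy of \<open>B\<close>
      beyond \<open>p\<close>, and \<open>2 * \<eta> \<le> 1 - r\<close> keeps it before the rotated
      copy of \<open>A\<close>.\<close>
    define \<eta> where "\<eta> = min r ((1 - r) / 2)"
    have \<eta>: "\<eta> > 0" "\<eta> \<le> r" "2 * \<eta> \<le> 1 - r"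
      using r01 by (auto simp: \<eta>_def min_def)
    have evA: "\<forall>\<^sub>F e in nhds (0::real). \<exists>t. \<bar>t - 1\<bar> < \<eta> \<and> p + t *\<^sub>R (D + e *\<^sub>R w) \<in> frontier C \<inter> U"
    proof (rule eventually_frontier_point_on_rotated_line[OF assms(1) UV(1) _ \<eta>(1)])
      show "p + 1 *\<^sub>R D \<in> U" using UV A_eq by simp
      fix \<delta> :: real assume "\<delta> > 0"
      \<comment> \<open>Capping the step inward at \<open>(1 - r) / 2\<close> keeps that parameter
        strictly between \<open>r\<close> and 1, where \<open>inner\<close> applies.\<close>
      then show "\<exists>t1 t2. \<bar>t1 - 1\<bar> < \<delta> \<and> \<bar>t2 - 1\<bar> < \<delta> \<and> p + t1 *\<^sub>R D \<in> interior C \<and> p + t2 *\<^sub>R D \<notin> C"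
        using r01
        by (intro exI[of _ "1 - min \<delta> (1 - r) / 2"] exI[of _ "1 + \<delta> / 2"] conjI inner outA)
           (auto simp: min_def field_simps)
    qed
    have evB: "\<forall>\<^sub>F e in nhds (0::real). \<exists>t. \<bar>t - r\<bar> < \<eta> \<and> p + t *\<^sub>R (D + e *\<^sub>R w) \<in> frontier C \<inter> V"
    proof (rule eventually_frontier_point_on_rotated_line[OF assms(1) UV(2) _ \<eta>(1)])
      show "p + r *\<^sub>R D \<in> V" using UV B_eq by simp
      fix \<delta> :: real assume "\<delta> > 0"
      then show "\<exists>t1 t2. \<bar>t1 - r\<bar> < \<delta> \<and> \<bar>t2 - r\<bar> < \<delta> \<and> p + t1 *\<^sub>R D \<in> interior C \<and> p + t2 *\<^sub>R D \<notin> C"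
        using r01
        by (intro exI[of _ "r + min \<delta> (1 - r) / 2"] exI[of _ "r - \<delta> / 2"] conjI inner outB)
           (auto simp: min_def field_simps)
    qed
    have "((\<lambda>e. \<alpha> + e * (a \<bullet> w)) \<longlongrightarrow> \<alpha> + 0 * (a \<bullet> w)) (nhds (0::real))"
      "((\<lambda>e. \<beta> - e * (b \<bullet> w)) \<longlongrightarrow> \<beta> - 0 * (b \<bullet> w)) (nhds (0::real))"
      by (intro tendsto_intros filterlim_ident)+
    then have pos: "\<forall>\<^sub>F e in nhds (0::real). \<alpha> + e * (a \<bullet> w) > 0"
      "\<forall>\<^sub>F e in nhds (0::real). \<beta> - e * (b \<bullet> w) > 0"
      using \<alpha> \<beta> by (auto dest: order_tendstoD(1)[where a = 0] simp del: diff_gt_0_iff_gt)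
    have g0: "g 0 = dist A B"
    proof -
      have "dist A B = norm ((1 - r) *\<^sub>R D)"
        unfolding dist_norm A_eq B_eq by (simp add: algebra_simps)
      also have "\<dots> = g 0"
        using r01 \<alpha> \<beta> unfolding norm_scaleR by (simp add: g_def norm_eq_sqrt_inner[of D])
      finally show ?thesis by simp
    qed
    have "\<forall>\<^sub>F e in nhds (0::real). g 0 \<le> g e"
      using evA evB pos
    proof eventually_elim
      case (elim e)
      let ?d = "D + e *\<^sub>R w"
      obtain t where t: "\<bar>t - 1\<bar> < \<eta>" "p + t *\<^sub>R ?d \<in> frontier C" "p + t *\<^sub>R ?d \<in> U"
        using elim(1) by blast
      obtain t' where t': "\<bar>t' - r\<bar> < \<eta>" "p + t' *\<^sub>R ?d \<in> frontier C" "p + t' *\<^sub>R ?d \<in> V"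
        using elim(2) by blast
      have tt: "0 < t'" "t' < t"
        using t(1) t'(1) \<eta> by auto
      have dd: "?d \<bullet> ?d = D \<bullet> D + e\<^sup>2 * (w \<bullet> w)"
        using w by (simp add: algebra_simps inner_commute power2_eq_square)
      have "D \<bullet> D > 0" "e\<^sup>2 * (w \<bullet> w) \<ge> 0"
        using D0 by auto
      then have "?d \<noteq> 0"
        using dd by (metis add_pos_nonneg inner_zero_left less_irrefl)
      then have "segment_through C p (p + t *\<^sub>R ?d) (p + t' *\<^sub>R ?d)"
        using segment_throughI t t' tt by blast
      then have "g 0 \<le> dist (p + t *\<^sub>R ?d) (p + t' *\<^sub>R ?d)"
        unfolding g0 using t(3) t'(3) by (rule min)
      also have "\<dots> = norm ((t - t') *\<^sub>R ?d)"
        by (simp add: dist_norm scaleR_left_diff_distrib)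
      also have "\<dots> = sqrt (D \<bullet> D + e\<^sup>2 * (w \<bullet> w)) * (t - t')"
        using tt unfolding norm_scaleR norm_eq_sqrt_inner[of ?d] dd by simp
      \<comment> \<open>\<open>C\<close> lies in both half-spaces, so its points on the rotated line
        have parameters between those of the two hyperplanes.\<close>
      also have "\<dots> \<le> g e"
      proof -
        have "p + t *\<^sub>R ?d \<in> C" "p + t' *\<^sub>R ?d \<in> C"
          using t(2) t'(2) assms(1) frontier_subset_closed by blast+
        then have "a \<bullet> (p + t *\<^sub>R ?d) \<le> a \<bullet> A" "b \<bullet> (p + t' *\<^sub>R ?d) \<le> b \<bullet> B"
          using a(2) b(2) by blast+
        then have "t * (\<alpha> + e * (a \<bullet> w)) \<le> \<alpha>" "r * \<beta> \<le> t' * (\<beta> - e * (b \<bullet> w))"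
          unfolding A_eq B_eq \<alpha>_def \<beta>_def by (simp_all add: algebra_simps)
        then have "t \<le> \<alpha> / (\<alpha> + e * (a \<bullet> w))" "r * \<beta> / (\<beta> - e * (b \<bullet> w)) \<le> t'"
          using elim(3,4) by (simp_all add: field_simps)
        then show ?thesis
          unfolding g_def by (intro mult_left_mono) auto
      qed
      finally show ?case .
    qed
    then obtain \<delta> where \<delta>: "\<delta> > 0" "\<And>e. \<bar>0 - e\<bar> < \<delta> \<Longrightarrow> g 0 \<le> g e"
      unfolding eventually_nhds_metric dist_real_def by (auto simp: abs_minus_commute)
    \<comment> \<open>The square root is even in \<open>e\<close> and smooth at 0 since
      \<open>D\<close> is nonzero, so only the bracket contributes to the derivative.\<close>
    have "(g has_real_derivative sqrt (D \<bullet> D) * (- (a \<bullet> w) / \<alpha> - r * (b \<bullet> w) / \<beta>)) (at 0)"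
      unfolding g_def using D0 \<alpha> \<beta>
      by (auto intro!: derivative_eq_intros simp: leD[OF inner_ge_zero] field_simps power2_eq_square)
    then have "sqrt (D \<bullet> D) * (- (a \<bullet> w) / \<alpha> - r * (b \<bullet> w) / \<beta>) = 0"
      using DERIV_local_min \<delta> by blast
    then show ?thesis
      using D0 by simp
  qed

  \<comment> \<open>By \<open>crit\<close>, \<open>u\<close> is orthogonal to everything orthogonal
    to \<open>D\<close>. Testing this with the component \<open>w\<close> of \<open>u\<close>
    orthogonal to \<open>D\<close> shows that \<open>u\<close> is a multiple of \<open>D\<close>;
    \<open>u \<bullet> D\<close> fixes the factor.\<close>
  define u where "u = (1 / \<alpha>) *\<^sub>R a + (r / \<beta>) *\<^sub>R b"
  define w where "w = u - ((u \<bullet> D) / (D \<bullet> D)) *\<^sub>R D"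
  have wD: "w \<bullet> D = 0"
    using D0 by (simp add: w_def inner_diff_left)
  have "u \<bullet> w = 0"
    using crit[OF wD] by (simp add: u_def inner_add_left)
  then have "w \<bullet> w = 0"
    using wD by (simp add: w_def inner_diff_left inner_commute)
  then have "u = ((u \<bullet> D) / (D \<bullet> D)) *\<^sub>R D"
    by (simp add: w_def)
  moreover have "u \<bullet> D = 1 - r"
    using \<alpha> \<beta> by (simp add: u_def inner_add_left \<alpha>_def[symmetric]) (simp add: \<beta>_def)
  ultimately have u: "u = ((1 - r) / (D \<bullet> D)) *\<^sub>R D"
    by simp
  \<comment> \<open>\<open>y\<close> is the component of \<open>b\<close> orthogonal to
    \<open>D\<close>: in \<open>comb\<close>, the multiple of \<open>D\<close> coming from
    \<open>u\<close> cancels the component of \<open>b\<close> along \<open>D\<close>.\<close>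
  define y where "y = b - ((b \<bullet> D) / (D \<bullet> D)) *\<^sub>R D"
  have "(\<beta> / \<alpha>) *\<^sub>R a + b = \<beta> *\<^sub>R u + (1 - r) *\<^sub>R b"
    using \<alpha> \<beta> by (simp add: u_def algebra_simps)
  also have "\<dots> = (1 - r) *\<^sub>R y"
    unfolding u y_def \<beta>_def
    by (simp add: algebra_simps flip: scaleR_left_distrib add_divide_distrib)
  finally have comb: "(\<beta> / \<alpha>) *\<^sub>R a + b = (1 - r) *\<^sub>R y" .
  have "y \<bullet> D = 0"
    using D0 by (simp add: y_def inner_diff_left)
  then have "b \<bullet> y = y \<bullet> y"
    by (simp add: y_def inner_diff_left inner_diff_right inner_commute)
  then have "norm y ^ 2 \<le> norm b * norm y"
    by (metis norm_cauchy_schwarz power2_norm_eq_inner)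
  then have "norm y \<le> norm b"
    by (cases "y = 0") (auto simp: power2_eq_square)
  have "dist p A * norm ((\<beta> / \<alpha>) *\<^sub>R a + b) = norm D * ((1 - r) * norm y)"
    using r01 unfolding comb A_eq by (simp add: dist_norm)
  also have "\<dots> \<le> norm D * ((1 - r) * norm b)"
    using r01 \<open>norm y \<le> norm b\<close> by (intro mult_left_mono) auto
  also have "\<dots> = norm ((1 - r) *\<^sub>R D) * norm b"
    using r01 by simp
  also have "(1 - r) *\<^sub>R D = A - B"
    unfolding A_eq B_eq by (simp add: algebra_simps)
  finally show ?thesis
    by (auto simp: dist_norm)
qed

section \<open>Uniform bounds over pairs of facets\<close>

text \<open>The norm on the right is the distance from \<open>b\<close> to a point of the line
  \<open>span {a}\<close>, which is closed and misses \<open>b\<close>. Dividing the distance to the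
  line by \<open>norm b\<close> gives \<open>c\<close>, in a form that lets \<open>norm b\<close>
  cancel later.\<close>

lemma norm_add_multiple_ge:
  fixes a b :: "'a::euclidean_space"
  assumes "b \<notin> span {a}"
  shows "\<exists>c>0. \<forall>x. c * norm b \<le> norm (x *\<^sub>R a + b)"
proof -
  have b0: "b \<noteq> 0"
    using assms span_zero by metis
  have "infdist b (span {a}) \<noteq> 0"
    using assms in_closed_iff_infdist_zero[of "span {a}" b] span_zero by auto
  then have pos: "infdist b (span {a}) > 0"
    using infdist_nonneg[of b "span {a}"] by linarith
  have "infdist b (span {a}) \<le> norm (x *\<^sub>R a + b)" for x
    using infdist_le[of "(- x) *\<^sub>R a" "span {a}" b]
    by (simp add: span_base span_scale span_neg dist_norm add.commute)
  then show ?thesis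
    using pos b0 by (intro exI[of _ "infdist b (span {a}) / norm b"]) auto
qed

lemma bounded_infdist_le:
  fixes C :: "'a::heine_borel set"
  assumes "compact C" "C \<noteq> {}"
  shows "bounded {p. infdist p C \<le> R}"
proof -
  obtain x M where M: "\<And>y. y \<in> C \<Longrightarrow> dist x y \<le> M"
    using compact_imp_bounded[OF assms(1)] unfolding bounded_def by blast
  have "dist x p \<le> M + R" if "infdist p C \<le> R" for p
  proof -
    obtain y where "y \<in> C" "infdist p C = dist p y"
      using infdist_attains_inf assms compact_imp_closed by blast
    then show ?thesis
      using M[of y] that dist_triangle[of x p y] by (simp add: dist_commute)
  qed
  then show ?thesis
    unfolding bounded_def by blast
qed

text \<open>The two opposite estimates for the normals at \<open>A\<close> and \<open>B\<close>
  bound \<open>dist p A\<close>, hence also \<open>infdist p C\<close>, by the diameter over a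
  constant that depends on the pair of facets only. There are finitely many pairs.\<close>

lemma local_minimizer_far_point_avoids_interior:
  fixes C :: "'a::euclidean_space set"
  assumes "polytope C" "interior C \<noteq> {}" "without_parallel_facets C"
  shows "\<exists>R. \<forall>p A B. p \<notin> C \<longrightarrow> infdist p C > R \<longrightarrow> local_minimizer C p A B \<longrightarrow>
    closed_segment A B \<inter> interior C = {}"
proof -
  define \<F> where "\<F> = {F. F facet_of C}"
  have "\<forall>F\<in>\<F>. \<exists>a b. a \<noteq> 0 \<and> C \<subseteq> {x. a \<bullet> x \<le> b} \<and> F = C \<inter> {x. a \<bullet> x = b}"
    using facet_of_iff_supporting_hyperplane[OF assms(1,2)] unfolding \<F>_def by blast
  then obtain n k where n: "\<And>F. F \<in> \<F> \<Longrightarrow>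
      n F \<noteq> 0 \<and> C \<subseteq> {x. n F \<bullet> x \<le> k F} \<and> F = C \<inter> {x. n F \<bullet> x = k F}"
    by metis
  \<comment> \<open>Linearly dependent normals would put two different facets into parallel
    hyperplanes.\<close>
  have "\<exists>c>0. \<forall>x. c * norm (n G) \<le> norm (x *\<^sub>R n F + n G)" if FG: "F \<in> \<F>" "G \<in> \<F>" "F \<noteq> G" for F G
  proof (rule norm_add_multiple_ge, rule notI)
    assume "n G \<in> span {n F}"
    then obtain q where q: "n G = q *\<^sub>R n F"
      by (auto simp: span_singleton)
    then have "q \<noteq> 0"
      using n FG by auto
    then have "{x. n G \<bullet> x = k G} = {x. n F \<bullet> x = k G / q}"
      by (auto simp: q field_simps)
    then have "parallel_hyperplanes {x. n F \<bullet> x = k F} {x. n G \<bullet> x = k G}"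
      unfolding parallel_hyperplanes_def using n FG by blast
    then show False
      using assms(3) n FG unfolding without_parallel_facets_def \<F>_def by blast
  qed
  then obtain c where c: "\<And>F G. F \<in> \<F> \<Longrightarrow> G \<in> \<F> \<Longrightarrow> F \<noteq> G \<Longrightarrow>
      c F G > 0 \<and> (\<forall>x. c F G * norm (n G) \<le> norm (x *\<^sub>R n F + n G))"
    by metis
  have "finite \<F>"
    unfolding \<F>_def by (intro finite_polyhedron_facets polytope_imp_polyhedron assms)
  \<comment> \<open>For \<open>F = G\<close> the value \<open>c F G\<close> is arbitrary, which at
    worst makes \<open>R\<close> larger.\<close>
  then have "\<exists>R. \<forall>F\<in>\<F>. \<forall>G\<in>\<F>. diameter C / c F G \<le> R"
    by (intro exI[of _ "Max ((\<lambda>(F, G). diameter C / c F G) ` (\<F> \<times> \<F>))"]) (auto intro!: Max_ge)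
  then obtain R where R: "\<And>F G. F \<in> \<F> \<Longrightarrow> G \<in> \<F> \<Longrightarrow> diameter C / c F G \<le> R"
    by blast
  have cl: "closed C" "convex C" "bounded C"
    using assms(1) polytope_imp_closed polytope_imp_convex polytope_imp_bounded by blast+
  have facets: "frontier C = \<Union>\<F>"
    using rel_frontier_of_polyhedron[OF polytope_imp_polyhedron[OF assms(1)]] assms(2)
    by (simp add: \<F>_def rel_frontier_nonempty_interior rel_frontier_frontier
        affine_hull_nonempty_interior)
  show ?thesis
  proof (intro exI[of _ R] allI impI, rule ccontr)
    fix p A B
    assume p: "p \<notin> C" "infdist p C > R" and lm: "local_minimizer C p A B"
      and ne: "closed_segment A B \<inter> interior C \<noteq> {}"
    have "A \<in> frontier C" "B \<in> frontier C"
      using lm by (auto simp: local_minimizer_def segment_through_def)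
    then obtain F G where FG: "F \<in> \<F>" "G \<in> \<F>" "A \<in> F" "B \<in> G"
      using facets by blast
    have AB: "A \<in> C" "B \<in> C"
      using FG n by blast+
    \<comment> \<open>A chord with both ends in one facet stays in that facet by convexity, so it
      would miss the interior.\<close>
    have "F \<noteq> G"
    proof
      assume "F = G"
      then have "closed_segment A B \<subseteq> F"
        using FG face_of_imp_convex[OF facet_of_imp_face_of]
        by (intro closed_segment_subset) (auto simp: \<F>_def)
      moreover have "F \<subseteq> frontier C"
        using facets FG by blast
      ultimately show False
        using ne by (auto simp: frontier_def)
    qed
    have "n F \<bullet> A = k F" "n G \<bullet> B = k G"
      using n FG by blast+
    then have nF: "n F \<noteq> 0" "C \<subseteq> {x. n F \<bullet> x \<le> n F \<bullet> A}" and nG: "n G \<noteq> 0" "C \<subseteq> {x. n G \<bullet> x \<le> n G \<bullet> B}"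
      using n[OF FG(1)] n[OF FG(2)] by simp_all
    obtain x where x: "dist p A * norm (x *\<^sub>R n F + n G) \<le> dist A B * norm (n G)"
      using local_minimizer_normals_nearly_parallel[OF cl(1,2) p(1) lm ne nF nG] by blast
    have cpos: "c F G > 0" and cle: "c F G * norm (n G) \<le> norm (x *\<^sub>R n F + n G)"
      using c FG \<open>F \<noteq> G\<close> by blast+
    have "(dist p A * c F G) * norm (n G) \<le> dist A B * norm (n G)"
      using x mult_left_mono[OF cle, of "dist p A"] by (simp add: mult.assoc)
    then have "dist p A * c F G \<le> dist A B"
      using nG(1) by simp
    also have "\<dots> \<le> diameter C"
      using AB cl(3) by (intro diameter_bounded_bound)
    finally have "dist p A \<le> diameter C / c F G"
      using cpos by (simp add: field_simps)
    then show False
      using R FG p(2) infdist_le[OF AB(1), of p] by force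
  qed
qed

theorem proposition32:
  fixes C :: "(real ^ 'n) set"
  assumes "CARD('n) \<ge> 2"
    and "polytope C"
    and "interior C \<noteq> {}"
    and "without_parallel_facets C"
  shows "(\<exists>U. bounded U \<and>
            (\<forall>p. p \<notin> U \<and> p \<notin> C \<longrightarrow>
               \<not> (\<exists>A B. local_minimizer C p A B \<and> closed_segment A B \<inter> interior C \<noteq> {}))) \<and>
         (\<exists>R. \<forall>p. p \<notin> C \<and> infdist p C > R \<longrightarrow>
               (\<forall>A B. local_minimizer C p A B \<longrightarrow> closed_segment A B \<subseteq> frontier C))"
proof -
  obtain R where R: "\<And>p A B. p \<notin> C \<Longrightarrow> infdist p C > R \<Longrightarrow> local_minimizer C p A B \<Longrightarrow>
      closed_segment A B \<inter> interior C = {}"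
    using local_minimizer_far_point_avoids_interior[OF assms(2-4)] by blast
  \<comment> \<open>This sublevel set serves as \<open>U\<close>, so that one \<open>R\<close>
    settles both claims.\<close>
  have "bounded {p. infdist p C \<le> R}"
    using assms(2,3) interior_subset by (intro bounded_infdist_le polytope_imp_compact) auto
  moreover have "\<forall>p. p \<notin> {p. infdist p C \<le> R} \<and> p \<notin> C \<longrightarrow>
      \<not> (\<exists>A B. local_minimizer C p A B \<and> closed_segment A B \<inter> interior C \<noteq> {})"
    using R by (auto simp: not_le)
  \<comment> \<open>By convexity the segment lies in \<open>C\<close>, and a point of the closed set
    \<open>C\<close> outside the interior is a frontier point.\<close>
  moreover have "closed_segment A B \<subseteq> frontier C"
    if "p \<notin> C" "infdist p C > R" "local_minimizer C p A B" for p A B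
  proof -
    have "closed C" "convex C"
      using assms(2) polytope_imp_closed polytope_imp_convex by blast+
    moreover have "A \<in> frontier C" "B \<in> frontier C"
      using that(3) by (auto simp: local_minimizer_def segment_through_def)
    ultimately have "closed_segment A B \<subseteq> C"
      using frontier_subset_closed by (intro closed_segment_subset) auto
    then show ?thesis
      using R[OF that] \<open>closed C\<close> by (auto simp: frontier_def)
  qed
  ultimately show ?thesis
    by blast
qed

end
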